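(* Let $n,k,t>0$ be integers with $k\ge t$. Let $\mathcal{C}\subset 2^{[N]}$ be a simplicial complex such that every inclusion-maximal set of $\mathcal{C}$ has size at least $n$, and assume $n\ge 2^{18}k^2\log_2 k$. Let $\mathcal{F}\subset\mathcal{C}^{(k)}$ be a $t$-intersecting family of maximum possible size. Then there exists a set $T$ of size $t$ such that $\mathcal{F}=\mathcal{C}^{(k)}[T]$. Moreover, if $\mathcal{F}$ is non-trivial, then $|\mathcal{F}|\le \frac12|\mathcal{C}^{(k)}[T]|$ for some $t$-element set $T$.
   Context: A simplicial complex $\mathcal{C}\subset 2^{[N]}$ is a family such that $A\in\mathcal{C}$ and $B\subset A$ imply $B\in\mathcal{C}$. $\mathcal{C}^{(k)}$ denotes the subfamily of all $k$-element sets of $\mathcal{C}$, and $\mathcal{C}^{(k)}[T]=\{F\in\mathcal{C}^{(k)}: T\subset F\}$. A family is $t$-intersecting if any two of its members (not necessarily distinct) share at least $t$ elements; a $t$-intersecting family $\mathcal{S}$ is non-trivial if $|\bigcap_{F\in\mathcal{S}}F|<t$. *)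

theory Defs
  imports Complex_Main
begin

definition simplicial_complex :: "nat \<Rightarrow> nat set set \<Rightarrow> bool" where
  "simplicial_complex N C \<longleftrightarrow> C \<subseteq> Pow {1..N} \<and> (\<forall>A\<in>C. \<forall>B. B \<subseteq> A \<longrightarrow> B \<in> C)"

definition inclusion_maximal :: "'a set set \<Rightarrow> 'a set \<Rightarrow> bool" where
  "inclusion_maximal C A \<longleftrightarrow> A \<in> C \<and> (\<forall>B\<in>C. A \<subseteq> B \<longrightarrow> B = A)"

definition layer :: "'a set set \<Rightarrow> nat \<Rightarrow> 'a set set" where
  "layer C k = {F \<in> C. card F = k}"

definition star :: "'a set set \<Rightarrow> 'a set \<Rightarrow> 'a set set" where
  "star S T = {F \<in> S. T \<subseteq> F}"

definition t_intersecting :: "nat \<Rightarrow> 'a set set \<Rightarrow> bool" where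
  "t_intersecting t S \<longleftrightarrow> (\<forall>A\<in>S. \<forall>B\<in>S. t \<le> card (A \<inter> B))"

text \<open>For the empty family \<open>\<Inter>S\<close> is \<open>UNIV\<close>, whose \<open>card\<close> over an infinite type is 0.
  So for \<open>t > 0\<close> the empty family of subsets of an infinite type counts as non-trivial;
  this is harmless for upper bounds on the size of non-trivial families.\<close>

definition nontrivial_t_intersecting :: "nat \<Rightarrow> 'a set set \<Rightarrow> bool" where
  "nontrivial_t_intersecting t S \<longleftrightarrow> t_intersecting t S \<and> card (\<Inter>S) < t"

definition maximum_t_intersecting :: "nat \<Rightarrow> 'a set set \<Rightarrow> 'a set set \<Rightarrow> bool" where
  "maximum_t_intersecting t S F \<longleftrightarrow>
     F \<subseteq> S \<and> t_intersecting t F \<and> (\<forall>G. G \<subseteq> S \<and> t_intersecting t G \<longrightarrow> card G \<le> card F)"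

end

theory Submission
  imports Defs "HOL-Library.FuncSet"
begin

text \<open>
  Every facet has at least \<open>n\<close> points, so double counting gives
  \<open>|C\<^sup>(\<^sup>k\<^sup>)[B]| \<le> r\<^bsup>t-|B|\<^esup> M\<close> for \<open>|B| \<ge> t\<close>, where \<open>r = (n+1-k)/k\<close> and \<open>M\<close> is the size of the largest
  star of a \<open>t\<close>-set. Let \<open>F\<close> be non-trivial and let \<open>X\<close> be a smallest set meeting every
  member of \<open>F\<close> in at least \<open>t\<close> points, \<open>|X| = t + i\<close> with \<open>i > 0\<close>. A set smaller than \<open>X\<close> is not
  such a cover, so it can be extended towards any member of \<open>F\<close> containing it in at most \<open>k\<close>
  ways by one point; hence \<open>|F[B]| \<le> k\<^bsup>t+i-|B|\<^esup> r\<^bsup>-i\<^esup> M\<close>.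

  It remains to determine \<open>D = X - A\<close> for \<open>A \<in> F\<close>; let \<open>d = |D| \<le> i\<close>. Trying all \<open>D\<close> would be too expensive when
  \<open>i\<close> is small compared to \<open>t\<close>. Instead apply the spread lemma of Alweiss, Lovasz, Wu and Zhang
  to the symmetric differences of \<open>X\<close> with the members \<open>A\<close>: a family of sets of size less than
  \<open>2\<^sup>R\<close> has two members with intersection \<open>Y\<close> such that a proportion of at least \<open>(16R)\<^bsup>-|Y|\<^esup>\<close> of the family
  contains \<open>Y\<close>. As the two corresponding members of \<open>F\<close> share \<open>t\<close> points, \<open>|Y| \<ge> 2d - i\<close>, so once \<open>Y\<close> is fixed
  at most \<open>i\<close> points remain to be chosen, each in at most \<open>k\<close> ways. This leaves
  at most \<open>(O(k log k) / r)\<^sup>i M\<close> sets for each \<open>d\<close>.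
\<close>

section \<open>The spread lemma\<close>

lemma finite_star: "finite S \<Longrightarrow> finite (star S T)"
  by (simp add: star_def)

text \<open>
  One round of the spread lemma, for uniform colourings \<open>c\<close> of the ground set with \<open>2R\<close> colours; \<open>U j c\<close>
  is the set of points with one of the first \<open>j\<close> colours. For a bad pair \<open>(S, c)\<close> let \<open>T \<subseteq> S\<close> be
  the smallest possible remainder \<open>A - U (j + 1) c\<close>, and recolour \<open>T\<close> with colour \<open>j\<close>. By minimality, \<open>T\<close>
  lies in a set of size less than \<open>2q\<close> that depends on the new colouring only, so it costs few choices
  to recover \<open>T\<close> and the old colours on it, while spreadness makes the sets \<open>S \<supseteq> T\<close> rare.
\<close>

lemma spread_round:
  fixes H :: "'a set set" and \<kappa> :: real and R j q :: nat
  defines "Col \<equiv> (\<Union>H) \<rightarrow>\<^sub>E {..<2 * R}"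
    and "U \<equiv> \<lambda>j c. {x \<in> \<Union>H. c x < j}"
  assumes fin: "finite H" "\<And>A. A \<in> H \<Longrightarrow> finite A"
    and R: "R > 0" "\<kappa> \<ge> 16 * real R" and j: "j < 2 * R" and q: "q > 0"
    and spread: "\<And>Z. finite Z \<Longrightarrow> \<kappa> ^ card Z * card (star H Z) \<le> card H"
  shows "real (card {(S, c) \<in> H \<times> Col.
            (\<exists>A\<in>H. A \<subseteq> S \<union> U j c \<and> card (A - U j c) < 2 * q) \<and>
            \<not> (\<exists>A\<in>H. A \<subseteq> S \<union> U (Suc j) c \<and> card (A - U (Suc j) c) < q)})
         \<le> real (card H) * real (card Col) * (1 / 2) ^ Suc q"
    (is "real (card ?Bad) \<le> _")
proof -
  define V where "V = \<Union>H"
  have finV: "finite V" using fin by (auto simp: V_def)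
  have finCol: "finite Col" unfolding Col_def V_def[symmetric] using finV by (simp add: finite_PiE)
  have cardCol: "card (T \<rightarrow>\<^sub>E {..<2 * R}) = (2 * R) ^ card T" if "finite T" for T :: "'a set"
    using that by (simp add: card_PiE)
  \<comment> \<open>\<open>good\<close> does not mention \<open>S\<close>: recolouring moves
    \<open>T\<close> into \<open>U (Suc j)\<close>, so a suitable set can be chosen from the new
    colouring alone, and \<open>\<psi>\<close> is its remainder.\<close>
  define good where "good = (\<lambda>c A. A \<in> H \<and> A \<subseteq> U (Suc j) c \<and> card (A - U j c) < 2 * q)"
  define \<psi> where "\<psi> = (\<lambda>c. if (\<exists>A. good c A) then (SOME A. good c A) - U j c else {})"
  have \<psi>_fin: "finite (\<psi> c)" and \<psi>_card: "card (\<psi> c) \<le> 2 * q - 1" for c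
  proof -
    have "finite (\<psi> c) \<and> card (\<psi> c) \<le> 2 * q - 1"
    proof (cases "\<exists>A. good c A")
      case True
      hence "good c (SOME A. good c A)" by (rule someI_ex)
      thus ?thesis using True fin by (auto simp: \<psi>_def good_def V_def)
    qed (auto simp: \<psi>_def)
    thus "finite (\<psi> c)" "card (\<psi> c) \<le> 2 * q - 1" by auto
  qed
  define Tc where "Tc = (\<lambda>c. {T. T \<subseteq> \<psi> c \<and> q \<le> card T})"
  \<comment> \<open>Contains every bad pair recoloured to \<open>c'\<close> along \<open>T\<close>:
    \<open>S\<close> is any member containing \<open>T\<close>, and the old colours on
    \<open>T\<close> are arbitrary.\<close>
  define Q where "Q = (\<lambda>c' T. star H T \<times>
    (\<lambda>g x. if x \<in> T then g x else c' x) ` (T \<rightarrow>\<^sub>E {..<2 * R}))"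
  have finT: "finite T" if "T \<in> Tc c" for T c
    using that \<psi>_fin finite_subset by (auto simp: Tc_def)
  have finTc: "finite (Tc c)" for c
    using \<psi>_fin[of c] by (auto simp: Tc_def)
  have finQ: "finite (Q c T)" if "finite T" for c T
    using fin(1) that by (auto simp: Q_def finite_star finite_PiE)
  have sub: "?Bad \<subseteq> (\<Union>c'\<in>Col. \<Union>T\<in>Tc c'. Q c' T)"
  proof (rule subsetI)
    fix p assume "p \<in> ?Bad"
    then obtain S c where p: "p = (S, c)" and S: "S \<in> H" and c: "c \<in> Col"
      and ex: "\<exists>A\<in>H. A \<subseteq> S \<union> U j c \<and> card (A - U j c) < 2 * q"
      and no: "\<not> (\<exists>A\<in>H. A \<subseteq> S \<union> U (Suc j) c \<and> card (A - U (Suc j) c) < q)" by blast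
    define cand where "cand = (\<lambda>A. A \<in> H \<and> A \<subseteq> S \<union> U (Suc j) c \<and> card (A - U j c) < 2 * q)"
    have "U j c \<subseteq> U (Suc j) c" by (auto simp: U_def)
    hence "\<exists>A. cand A" using ex by (fastforce simp: cand_def)
    then obtain A where A: "cand A"
      and Amin: "\<And>A'. cand A' \<Longrightarrow> card (A - U (Suc j) c) \<le> card (A' - U (Suc j) c)"
      using ex_has_least_nat[of cand _ "\<lambda>A. card (A - U (Suc j) c)"] by blast
    define T where "T = A - U (Suc j) c"
    have TS: "T \<subseteq> S" using A by (auto simp: T_def cand_def)
    have Tq: "q \<le> card T" using A no by (auto simp: T_def cand_def not_less)
    have TV: "T \<subseteq> V" using A by (auto simp: T_def cand_def V_def)
    have fT: "finite T" using TV finV finite_subset by blast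
    have Tj: "\<not> c x < Suc j" if "x \<in> T" for x using that TV by (auto simp: T_def U_def V_def)
    define c' where "c' = (\<lambda>x. if x \<in> T then j else c x)"
    have c'Col: "c' \<in> Col" using c j TV by (auto simp: c'_def Col_def V_def PiE_iff extensional_def)
    have Uj: "U j c' = U j c" by (auto simp: U_def c'_def dest: Tj)
    have USj: "U (Suc j) c' = U (Suc j) c \<union> T"
      using Tj TV by (auto simp: U_def c'_def V_def split: if_splits)
    have "good c' A" using A by (auto simp: good_def Uj USj cand_def T_def)
    hence exg: "\<exists>A. good c' A" by blast
    define B where "B = (SOME A. good c' A)"
    have B: "good c' B" unfolding B_def using exg by (rule someI_ex)
    have \<psi>: "\<psi> c' = B - U j c'" using exg by (simp add: \<psi>_def B_def)
    \<comment> \<open>\<open>B\<close> is also a candidate for \<open>(S, c)\<close>, because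
      \<open>T \<subseteq> S\<close>. Its remainder lies in \<open>T\<close>, so minimality forces
      it to be all of \<open>T\<close>, which places \<open>T\<close> inside
      \<open>\<psi> c'\<close>.\<close>
    have "cand B" using B TS by (auto simp: good_def cand_def Uj USj)
    hence "card T \<le> card (B - U (Suc j) c)" using Amin by (simp add: T_def)
    moreover have "B - U (Suc j) c \<subseteq> T" using B by (auto simp: good_def USj)
    ultimately have "B - U (Suc j) c = T" using fT card_seteq by blast
    hence "T \<subseteq> \<psi> c'" using \<psi> Uj Tj by (auto simp: U_def)
    hence TTc: "T \<in> Tc c'" using Tq by (simp add: Tc_def)
    have "c = (\<lambda>x. if x \<in> T then restrict c T x else c' x)" by (auto simp: c'_def)
    moreover have "restrict c T \<in> T \<rightarrow>\<^sub>E {..<2 * R}"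
      using c TV by (auto simp: Col_def V_def)
    ultimately have "c \<in> (\<lambda>g x. if x \<in> T then g x else c' x) ` (T \<rightarrow>\<^sub>E {..<2 * R})"
      by (rule image_eqI)
    hence "(S, c) \<in> Q c' T"
      unfolding Q_def using S TS by (simp add: star_def)
    thus "p \<in> (\<Union>c'\<in>Col. \<Union>T\<in>Tc c'. Q c' T)" using c'Col TTc p by blast
  qed
  have cQ: "real (card (Q c T)) \<le> card H * (1 / 8) ^ q" if "T \<in> Tc c" for c T
  proof -
    have fT: "finite T" and Tq: "q \<le> card T" using finT[OF that] that by (simp_all add: Tc_def)
    have \<kappa>: "\<kappa> > 0" using R by linarith
    have "card ((\<lambda>g x. if x \<in> T then g x else c x) ` (T \<rightarrow>\<^sub>E {..<2 * R}))
          \<le> card (T \<rightarrow>\<^sub>E {..<2 * R})"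
      using fT by (intro card_image_le finite_PiE) auto
    hence "card (Q c T) \<le> card (star H T) * (2 * R) ^ card T"
      unfolding Q_def card_cartesian_product cardCol[OF fT] by (rule mult_le_mono2)
    hence "real (card (Q c T)) \<le> card (star H T) * (2 * R) ^ card T"
      by (rule of_nat_mono)
    also have "\<dots> \<le> card H / \<kappa> ^ card T * (2 * R) ^ card T"
      unfolding of_nat_mult using spread[OF fT] \<kappa> by (intro mult_right_mono) (auto simp: field_simps)
    also have "\<dots> = card H * (2 * R / \<kappa>) ^ card T"
      by (simp add: power_divide)
    \<comment> \<open>Each point of \<open>T\<close> has \<open>2 * R\<close> possible old colours,
      against a factor \<open>1 / \<kappa>\<close> from spreadness.\<close>
    also have "\<dots> \<le> card H * (1 / 8) ^ card T"
      using R \<kappa> by (intro mult_left_mono power_mono) (auto simp: field_simps)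
    also have "\<dots> \<le> card H * (1 / 8) ^ q"
      using Tq by (intro mult_left_mono power_decreasing) auto
    finally show ?thesis .
  qed
  have cTc: "real (card (Tc c)) \<le> 2 ^ (2 * q - 1)" for c
  proof -
    have "card (Tc c) \<le> card (Pow (\<psi> c))"
      using \<psi>_fin by (intro card_mono) (auto simp: Tc_def)
    also have "\<dots> \<le> 2 ^ (2 * q - 1)" using \<psi>_card \<psi>_fin by (simp add: card_Pow)
    finally show ?thesis by (metis of_nat_le_iff of_nat_numeral of_nat_power)
  qed
  have "real (card ?Bad) \<le> real (card (\<Union>c'\<in>Col. \<Union>T\<in>Tc c'. Q c' T))"
    using sub finCol finTc finQ finT by (intro of_nat_mono card_mono) auto
  also have "\<dots> \<le> real (\<Sum>c'\<in>Col. \<Sum>T\<in>Tc c'. card (Q c' T))"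
  proof (rule of_nat_mono)
    have "card (\<Union>c'\<in>Col. \<Union>T\<in>Tc c'. Q c' T) \<le> (\<Sum>c'\<in>Col. card (\<Union>T\<in>Tc c'. Q c' T))"
      by (rule card_UN_le[OF finCol])
    also have "\<dots> \<le> (\<Sum>c'\<in>Col. \<Sum>T\<in>Tc c'. card (Q c' T))"
      by (intro sum_mono card_UN_le finTc)
    finally show "card (\<Union>c'\<in>Col. \<Union>T\<in>Tc c'. Q c' T) \<le> \<dots>" .
  qed
  also have "\<dots> \<le> (\<Sum>c'\<in>Col. 2 ^ (2 * q - 1) * (card H * (1 / 8) ^ q))"
  proof -
    have "(\<Sum>T\<in>Tc c'. real (card (Q c' T))) \<le> 2 ^ (2 * q - 1) * (card H * (1 / 8) ^ q)" for c'
    proof -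
      have "(\<Sum>T\<in>Tc c'. real (card (Q c' T))) \<le> real (card (Tc c')) * (card H * (1 / 8) ^ q)"
        using cQ by (intro sum_bounded_above) auto
      also have "\<dots> \<le> 2 ^ (2 * q - 1) * (card H * (1 / 8) ^ q)"
        using cTc by (intro mult_right_mono) auto
      finally show ?thesis .
    qed
    thus ?thesis unfolding of_nat_sum by (intro sum_mono) simp
  qed
  also have "\<dots> = real (card H) * real (card Col) * (1 / 2) ^ Suc q"
  proof -
    obtain e where e: "q = Suc e" using q not0_implies_Suc by blast
    have "(2::real) ^ (2 * q - 1) * (1 / 8) ^ q = (1 / 2) ^ Suc q"
      unfolding e power_mult[symmetric]
      by (induction e) simp_all
    thus ?thesis by simp
  qed
  finally show ?thesis .
qed

text \<open>In \<open>R\<close> rounds the allowed remainder shrinks from below \<open>2 ^ R\<close>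
  to empty, so for more than half of the colourings the points in the first half of the colours
  contain a member of \<open>H\<close>. By symmetry the same holds for the complement, and some
  colouring achieves both.\<close>

lemma spread_disjoint_pair:
  fixes H :: "'a set set" and \<kappa> :: real and R :: nat
  assumes fin: "finite H" "\<And>A. A \<in> H \<Longrightarrow> finite A" and ne: "H \<noteq> {}"
    and R: "R > 0" "\<kappa> \<ge> 16 * real R" and small: "\<And>A. A \<in> H \<Longrightarrow> card A < 2 ^ R"
    and spread: "\<And>Z. finite Z \<Longrightarrow> \<kappa> ^ card Z * card (star H Z) \<le> card H"
  obtains A B where "A \<in> H" "B \<in> H" "A \<inter> B = {}"
proof -
  define V where "V = \<Union>H"
  define Col where "Col = V \<rightarrow>\<^sub>E {..<2 * R}"
  define U where "U = (\<lambda>j c. {x \<in> V. c x < (j::nat)})"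
  define P where "P = (\<lambda>j S c. \<exists>A\<in>H. A \<subseteq> S \<union> U j c \<and> card (A - U j c) < 2 ^ (R - j))"
  define Fail where "Fail = (\<lambda>j. {(S, c) \<in> H \<times> Col. \<not> P j S c})"
  have finV: "finite V" using fin by (auto simp: V_def)
  have finCol: "finite Col" using finV by (simp add: Col_def finite_PiE)
  have cardCol: "card Col > 0"
    using R finV by (simp add: Col_def card_PiE)
  have finFail: "finite (Fail j)" for j
    by (rule finite_subset[of _ "H \<times> Col"]) (use fin finCol in \<open>auto simp: Fail_def\<close>)
  \<comment> \<open>Partial sum of a geometric series; subtracting \<open>(1 / 2) ^ R\<close> keeps
    the failure rate strictly below \<open>1 / 2\<close> at \<open>j = R\<close>.\<close>
  have "real (card (Fail j)) \<le> card H * card Col * (((1 / 2) ^ (R - j) - (1 / 2) ^ R) / 2)"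
    if "j \<le> R" for j
    using that
  proof (induction j)
    case 0
    have "P 0 S c" if "S \<in> H" for S c
      using that small by (auto simp: P_def U_def)
    hence "Fail 0 = {}" by (auto simp: Fail_def)
    thus ?case by simp
  next
    case (Suc j)
    define e where "e = R - Suc j"
    have e: "R - j = Suc e" using Suc.prems by (simp add: e_def)
    define Bad where "Bad = {(S, c). (S, c) \<in> H \<times> Col \<and> P j S c \<and> \<not> P (Suc j) S c}"
    have "real (card Bad) \<le> real (card H) * real (card Col) * (1 / 2) ^ Suc (2 ^ e)"
    proof -
      have j: "j < 2 * R" using Suc.prems by simp
      have pow: "(2::nat) ^ (R - j) = 2 * 2 ^ e" by (simp add: e)
      show ?thesis
        using spread_round[OF fin R j _ spread, of "2 ^ e"]
        unfolding Bad_def P_def pow e_def[symmetric] U_def V_def Col_def by simp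
    qed
    \<comment> \<open>\<open>e + 1 \<le> 2 ^ e\<close> trades the doubly exponential bound for a
      term of the geometric series.\<close>
    also have "\<dots> \<le> real (card H) * real (card Col) * (1 / 2) ^ Suc (Suc e)"
      by (intro mult_left_mono power_decreasing) (auto simp: Suc_le_eq less_exp)
    finally have bad: "real (card Bad) \<le> card H * card Col * ((1 / 2) ^ Suc (Suc e))"
      by simp
    have "Fail (Suc j) \<subseteq> Fail j \<union> Bad" by (auto simp: Fail_def Bad_def)
    moreover have "finite Bad"
      by (rule finite_subset[of _ "H \<times> Col"]) (use fin finCol in \<open>auto simp: Bad_def\<close>)
    ultimately have "card (Fail (Suc j)) \<le> card (Fail j) + card Bad"
      using finFail by (meson card_Un_le card_mono finite_UnI le_trans)
    hence "real (card (Fail (Suc j))) \<le> real (card (Fail j)) + real (card Bad)" by linarith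
    also have "\<dots> \<le> card H * card Col * (((1 / 2) ^ (R - j) - (1 / 2) ^ R) / 2)
         + card H * card Col * ((1 / 2) ^ Suc (Suc e))"
      using Suc bad by (intro add_mono) auto
    also have "\<dots> = card H * card Col * (((1 / 2) ^ e - (1 / 2) ^ R) / 2)"
      unfolding e by (simp add: field_simps)
    finally show ?case by (simp add: e_def)
  qed
  from this[of R] have "real (card (Fail R)) \<le> card H * card Col * ((1 - (1 / 2) ^ R) / 2)"
    by simp
  also have "\<dots> < card H * card Col * (1 / 2)"
    using cardCol ne fin by (intro mult_strict_left_mono) (auto simp: card_gt_0_iff)
  finally have failR: "2 * card (Fail R) < card H * card Col"
    using of_nat_less_iff[where 'a = real, of "2 * card (Fail R)" "card H * card Col"] by simp
  \<comment> \<open>Reversing the order of the colours exchanges \<open>U R c\<close> and its complement.\<close>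
  define G1 where "G1 = {c \<in> Col. \<not> (\<exists>A\<in>H. A \<subseteq> U R c)}"
  define G2 where "G2 = {c \<in> Col. \<not> (\<exists>A\<in>H. A \<subseteq> V - U R c)}"
  have finG: "finite G1" "finite G2" using finCol by (auto simp: G1_def G2_def)
  \<comment> \<open>A remainder with fewer than \<open>2 ^ 0\<close> points is empty, so if
    \<open>U R c\<close> contains no member of \<open>H\<close>, every \<open>S\<close> fails with
    \<open>c\<close>.\<close>
  have "H \<times> G1 \<subseteq> Fail R"
    using fin(2) by (auto simp: Fail_def G1_def P_def)
  hence "card H * card G1 \<le> card (Fail R)"
    using finFail card_mono card_cartesian_product by metis
  hence "card H * (2 * card G1) < card H * card Col" using failR by linarith
  hence G1: "2 * card G1 < card Col" by simp
  define flip where "flip = (\<lambda>c. \<lambda>x\<in>V. 2 * R - 1 - (c x :: nat))"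
  have "card G2 \<le> card G1"
  proof (rule card_inj_on_le[where f = flip])
    show "inj_on flip G2"
    proof (rule inj_onI)
      fix c d assume cd: "c \<in> G2" "d \<in> G2" "flip c = flip d"
      hence ext: "c \<in> V \<rightarrow>\<^sub>E {..<2 * R}" "d \<in> V \<rightarrow>\<^sub>E {..<2 * R}"
        by (auto simp: G2_def Col_def)
      have "c x = d x" if "x \<in> V" for x
      proof -
        have "c x < 2 * R" "d x < 2 * R" using ext that by (auto simp: PiE_iff)
        moreover have "2 * R - 1 - c x = 2 * R - 1 - d x"
          using fun_cong[OF cd(3), of x] that by (simp add: flip_def)
        ultimately show ?thesis by linarith
      qed
      thus "c = d" using ext by (intro PiE_ext) auto
    qed
    show "flip ` G2 \<subseteq> G1"
    proof (rule image_subsetI)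
      fix c assume c: "c \<in> G2"
      have "U R (flip c) = V - U R c"
        using c by (auto simp: U_def flip_def G2_def Col_def PiE_iff)
      moreover have "flip c \<in> Col" using R by (auto simp: flip_def Col_def)
      ultimately show "flip c \<in> G1" using c by (auto simp: G1_def G2_def)
    qed
  qed (use finG in auto)
  hence "card (G1 \<union> G2) < card Col" using G1 card_Un_le[of G1 G2] by linarith
  moreover have "G1 \<union> G2 \<subseteq> Col" by (auto simp: G1_def G2_def)
  ultimately have "\<exists>c\<in>Col. c \<notin> G1 \<union> G2" by (metis less_irrefl subset_antisym subsetI)
  then obtain c A B where "A \<in> H" "A \<subseteq> U R c" "B \<in> H" "B \<subseteq> V - U R c"
    by (auto simp: G1_def G2_def)
  thus ?thesis using that[of A B] by blast
qed

text \<open>A set \<open>Y\<close> maximising \<open>\<kappa>\<^bsup>|Y|\<^esup> |H[Y]|\<close> has a spread link, whose disjoint members give the pair.\<close>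

lemma spread_pair:
  fixes H :: "'a set set" and \<kappa> :: real and R :: nat
  assumes fin: "finite H" "\<And>A. A \<in> H \<Longrightarrow> finite A" and ne: "H \<noteq> {}"
    and R: "R > 0" "\<kappa> \<ge> 16 * real R" and small: "\<And>A. A \<in> H \<Longrightarrow> card A < 2 ^ R"
  obtains A B where "A \<in> H" "B \<in> H" "card H \<le> \<kappa> ^ card (A \<inter> B) * card (star H (A \<inter> B))"
proof -
  define f where "f = (\<lambda>Y. \<kappa> ^ card Y * card (star H Y))"
  have \<kappa>: "\<kappa> > 0" using R by linarith
  have finV: "finite (\<Union>H)" using fin by auto
  have "finite (f ` Pow (\<Union>H))" "f ` Pow (\<Union>H) \<noteq> {}" using finV by auto
  from Max_in[OF this] obtain Y where Y: "Y \<subseteq> \<Union>H" and "f Y = Max (f ` Pow (\<Union>H))"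
    by force
  hence Ymax: "f Z \<le> f Y" if "Z \<subseteq> \<Union>H" for Z
    using that finV by simp
  have finY: "finite Y" using Y finV finite_subset by blast
  define L where "L = (\<lambda>A. A - Y) ` star H Y"
  have inj: "inj_on (\<lambda>A. A - Y) (star H Y)"
    by (rule inj_onI) (auto simp: star_def)
  have cL: "card L = card (star H Y)" unfolding L_def using inj by (rule card_image)
  have HY: "card H \<le> \<kappa> ^ card Y * card (star H Y)"
    using Ymax[of "{}"] by (simp add: f_def star_def)
  have neY: "star H Y \<noteq> {}"
  proof
    assume "star H Y = {}"
    thus False using HY ne fin(1) by simp
  qed
  have spr: "\<kappa> ^ card Z * card (star L Z) \<le> card L" if Z: "finite Z" for Z
  proof (cases "star L Z = {}")
    case False
    \<comment> \<open>The witness shows that \<open>Z\<close> is disjoint from \<open>Y\<close>, so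
      the exponents of \<open>\<kappa>\<close> add up, and that \<open>Y \<union> Z\<close> competes
      with \<open>Y\<close> in the maximum.\<close>
    then obtain A where A: "A \<in> H" "Y \<subseteq> A" "Z \<subseteq> A - Y" by (auto simp: star_def L_def)
    have "star L Z \<subseteq> (\<lambda>A. A - Y) ` star H (Y \<union> Z)"
      by (auto simp: star_def L_def)
    hence "card (star L Z) \<le> card (star H (Y \<union> Z))"
      using fin(1) by (meson finite_star surj_card_le)
    hence "\<kappa> ^ card Y * (\<kappa> ^ card Z * card (star L Z)) \<le> f (Y \<union> Z)"
    proof -
      have "card (Y \<union> Z) = card Y + card Z" using A finY Z by (intro card_Un_disjoint) auto
      thus ?thesis using \<kappa> \<open>card (star L Z) \<le> card (star H (Y \<union> Z))\<close>
        by (simp add: f_def power_add mult.assoc)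
    qed
    also have "\<dots> \<le> f Y" using A by (intro Ymax) auto
    also have "\<dots> = \<kappa> ^ card Y * card L" by (simp add: f_def cL)
    finally show ?thesis using \<kappa> by simp
  qed simp
  have smallL: "finite A \<and> card A < 2 ^ R" if "A \<in> L" for A
  proof -
    obtain A' where "A' \<in> H" "A = A' - Y" using \<open>A \<in> L\<close> by (auto simp: L_def star_def)
    thus ?thesis using fin(2) small card_mono[of A' A]
      by (metis Diff_subset finite_Diff le_less_trans)
  qed
  have finL: "finite L" using fin(1) by (simp add: L_def finite_star)
  have neL: "L \<noteq> {}" using neY by (simp add: L_def)
  obtain A' B' where "A' \<in> L" "B' \<in> L" "A' \<inter> B' = {}"
    using spread_disjoint_pair[OF finL _ neL R _ spr] smallL by blast
  then obtain A B where "A \<in> H" "B \<in> H" "Y \<subseteq> A" "Y \<subseteq> B" "(A - Y) \<inter> (B - Y) = {}"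
    by (auto simp: L_def star_def)
  moreover from this have "A \<inter> B = Y" by blast
  ultimately show ?thesis using that[of A B] HY by simp
qed

section \<open>Counting members by their defect from a minimal cover\<close>

text \<open>A set \<open>B\<close> below size \<open>\<tau>\<close> meets some \<open>G\<close> in
  fewer than \<open>t\<close> points, whereas every member containing \<open>B\<close> meets
  \<open>G\<close> in at least \<open>t\<close>. Such a member thus contains one of the at most
  \<open>k\<close> points of \<open>G - B\<close>.\<close>

lemma star_branching:
  fixes F :: "'a set set" and b :: real
  assumes finF: "finite F" and mem: "\<And>A. A \<in> F \<Longrightarrow> finite A \<and> card A \<le> k"
    and int: "t_intersecting t F"
    and noncover: "\<And>B. finite B \<Longrightarrow> card B < \<tau> \<Longrightarrow> \<exists>G\<in>F. card (B \<inter> G) < t"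
    and base: "\<And>B. finite B \<Longrightarrow> card B = \<tau> \<Longrightarrow> real (card (star F B)) \<le> b"
    and B: "finite B" "card B \<le> \<tau>"
  shows "real (card (star F B)) \<le> real k ^ (\<tau> - card B) * b"
  using B
proof (induction "\<tau> - card B" arbitrary: B)
  case 0
  thus ?case using base by simp
next
  case (Suc m)
  hence "card B < \<tau>" by simp
  then obtain G where G: "G \<in> F" "card (B \<inter> G) < t" using noncover Suc.prems by blast
  have finG: "finite (G - B)" and cG: "card (G - B) \<le> k"
    using mem[OF G(1)] card_mono[of G "G - B"] by auto
  have IH: "real (card (star F (insert x B))) \<le> real k ^ m * b" if "x \<in> G - B" for x
  proof -
    have "card (insert x B) = Suc (card B)" using that Suc.prems by simp
    moreover from this have m: "m = \<tau> - card (insert x B)" using Suc.hyps(2) by linarith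
    ultimately show ?thesis using Suc.hyps(1)[OF m] Suc.prems \<open>card B < \<tau>\<close> m by simp
  qed
  have "star F B \<subseteq> (\<Union>x\<in>G - B. star F (insert x B))"
  proof
    fix A assume A: "A \<in> star F B"
    hence "t \<le> card (A \<inter> G)" using int G by (auto simp: t_intersecting_def star_def)
    hence "\<not> A \<inter> G \<subseteq> B \<inter> G"
      using G(2) Suc.prems(1) by (meson card_mono finite_Int le_less_trans not_less)
    thus "A \<in> (\<Union>x\<in>G - B. star F (insert x B))" using A by (auto simp: star_def)
  qed
  hence "card (star F B) \<le> card (\<Union>x\<in>G - B. star F (insert x B))"
    using finG finF by (intro card_mono) (auto simp: finite_star)
  also have "\<dots> \<le> (\<Sum>x\<in>G - B. card (star F (insert x B)))"
    by (rule card_UN_le[OF finG])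
  finally have "real (card (star F B)) \<le> (\<Sum>x\<in>G - B. real (card (star F (insert x B))))"
    by (metis of_nat_le_iff of_nat_sum)
  also have "\<dots> \<le> real (card (G - B)) * (real k ^ m * b)"
    using IH by (intro sum_bounded_above) auto
  \<comment> \<open>The sign of \<open>b\<close> comes from the induction hypothesis at a point of
    \<open>G - B\<close>. Such a point exists: otherwise \<open>G \<subseteq> B\<close> has fewer
    than \<open>t\<close> points, against \<open>t \<le> card (G \<inter> G)\<close>.\<close>
  also have "\<dots> \<le> real k * (real k ^ m * b)"
  proof (cases "G - B = {}")
    case False
    then obtain x where "x \<in> G - B" by blast
    hence "0 \<le> real k ^ m * b" using IH[of x] by linarith
    thus ?thesis using cG by (intro mult_right_mono) auto
  next
    case True
    have "G \<inter> B = G" using True by blast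
    hence "card G < t" using G(2) by (simp add: Int_commute)
    moreover have "t \<le> card (G \<inter> G)" using int G(1) unfolding t_intersecting_def by blast
    ultimately show ?thesis by simp
  qed
  finally show ?case by (simp flip: Suc.hyps(2))
qed

text \<open>Exponent bookkeeping for the defect count: surplus factors \<open>\<kappa>\<close>
  beyond the \<open>i\<close>-th are raised to \<open>K\<close>, and the bound on
  \<open>s + u\<close> leaves room for them.\<close>

lemma power_balance:
  fixes \<kappa> K :: real
  assumes "1 \<le> \<kappa>" "\<kappa> \<le> K" "u \<le> i" "s + u \<le> 2 * i"
  shows "\<kappa> ^ s * K ^ u \<le> \<kappa> ^ i * K ^ i"
proof (cases "s \<le> i")
  case True
  thus ?thesis using assms by (intro mult_mono power_increasing) auto
next
  case False
  hence "\<kappa> ^ s * K ^ u = \<kappa> ^ i * (\<kappa> ^ (s - i) * K ^ u)"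
    by (simp flip: power_add mult.assoc)
  also have "\<dots> \<le> \<kappa> ^ i * (K ^ (s - i) * K ^ u)"
    using assms by (intro mult_left_mono mult_right_mono power_mono) auto
  also have "\<dots> = \<kappa> ^ i * K ^ (s - i + u)" by (simp add: power_add)
  also have "\<dots> \<le> \<kappa> ^ i * K ^ i"
    using assms False by (intro mult_left_mono power_increasing) auto
  finally show ?thesis .
qed

lemma card_subsets_between_le:
  assumes "finite X" "Y \<subseteq> X" "card Y \<le> d"
  shows "card {D. Y \<subseteq> D \<and> D \<subseteq> X \<and> card D = d} \<le> card X ^ (d - card Y)"
proof -
  have finY: "finite Y" using assms finite_subset by blast
  let ?E = "{E. E \<subseteq> X - Y \<and> card E = d - card Y}"
  have "{D. Y \<subseteq> D \<and> D \<subseteq> X \<and> card D = d} \<subseteq> (\<lambda>E. E \<union> Y) ` ?E"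
  proof
    fix D assume D: "D \<in> {D. Y \<subseteq> D \<and> D \<subseteq> X \<and> card D = d}"
    hence "D - Y \<in> ?E" using finY by (auto simp: card_Diff_subset)
    moreover have "D = (D - Y) \<union> Y" using D by blast
    ultimately show "D \<in> (\<lambda>E. E \<union> Y) ` ?E" by blast
  qed
  hence "card {D. Y \<subseteq> D \<and> D \<subseteq> X \<and> card D = d} \<le> card ?E"
    using assms by (intro surj_card_le) auto
  also have "\<dots> = card (X - Y) choose (d - card Y)"
    using assms by (intro n_subsets) auto
  also have "\<dots> \<le> card (X - Y) ^ (d - card Y)"
    by (cases "d - card Y \<le> card (X - Y)") (auto simp: binomial_le_pow binomial_eq_0)
  also have "\<dots> \<le> card X ^ (d - card Y)"
    using assms by (intro power_mono card_mono) auto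
  finally show ?thesis .
qed

text \<open>The spread lemma fixes \<open>Y\<close>, with \<open>a\<close> points in
  \<open>X\<close> and \<open>b\<close> outside, at a cost of \<open>\<kappa> ^ (a + b)\<close>. The
  \<open>a\<close> points belong to \<open>X - A\<close>, leaving at most \<open>K ^ (d - a)\<close>
  candidates \<open>D\<close>. The member then contains \<open>(X - D) \<union> (Y - X)\<close>, and
  branching up to size \<open>t + i\<close> costs \<open>K ^ (d - b)\<close>.\<close>

lemma cover_defect_bound:
  fixes F :: "'a set set" and M r \<kappa> K :: real
  assumes finF: "finite F" and mem: "\<And>A. A \<in> F \<Longrightarrow> finite A \<and> card A \<le> k"
    and int: "t_intersecting t F"
    and X: "finite X" "card X = t + i" "t + i \<le> k"
    and noncover: "\<And>B. finite B \<Longrightarrow> card B < t + i \<Longrightarrow> \<exists>G\<in>F. card (B \<inter> G) < t"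
    and stars: "\<And>B. finite B \<Longrightarrow> t \<le> card B \<Longrightarrow> r ^ (card B - t) * card (star F B) \<le> M"
    and R: "2 * k < 2 ^ R" "R > 0" and \<kappa>: "\<kappa> = 16 * real R"
    and K: "\<kappa> \<le> K" "real k \<le> K" and r: "\<kappa> \<le> r" and d: "d \<le> i"
  shows "r ^ i * card {A \<in> F. card (X - A) = d} \<le> (\<kappa> * K) ^ i * M"
proof (cases "{A \<in> F. card (X - A) = d} = {}")
  case True
  have "0 \<le> M" using stars[OF X(1)] X(2) r R \<kappa> by (smt (verit) le_add1 of_nat_0_le_iff zero_le_mult_iff zero_le_power)
  moreover have "0 \<le> \<kappa> * K" using \<kappa> K by (intro mult_nonneg_nonneg) auto
  ultimately show ?thesis unfolding True by simp
next
  case False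
  define Fd where "Fd = {A \<in> F. card (X - A) = d}"
  have \<kappa>1: "1 \<le> \<kappa>" using R \<kappa> by simp
  have r1: "1 \<le> r" and K1: "1 \<le> K" using \<kappa>1 r K by linarith+
  have M: "0 \<le> M" using stars[OF X(1)] X(2) r1
    by (smt (verit) le_add1 of_nat_0_le_iff zero_le_mult_iff zero_le_power)
  define \<Phi> where "\<Phi> = (\<lambda>A. (A - X) \<union> (X - A))"
  have inj: "inj_on \<Phi> S" for S by (rule inj_onI) (auto simp: \<Phi>_def)
  define H where "H = \<Phi> ` Fd"
  have finFd: "finite Fd" using finF by (simp add: Fd_def)
  have finH: "finite H" and neH: "H \<noteq> {}" using finFd False by (auto simp: H_def Fd_def)
  have H: "finite A \<and> card A < 2 ^ R" if AH: "A \<in> H" for A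
  proof -
    obtain A' where A': "A' \<in> F" "A = \<Phi> A'" using AH by (auto simp: H_def Fd_def)
    have "card A \<le> card (A' - X) + card (X - A')" unfolding A'(2) \<Phi>_def by (rule card_Un_le)
    also have "\<dots> \<le> card A' + card X"
      using mem[OF A'(1)] X(1) by (intro add_mono card_mono) auto
    also have "\<dots> < 2 ^ R" using mem[OF A'(1)] X R by linarith
    finally show ?thesis using mem[OF A'(1)] X(1) A'(2) by (auto simp: \<Phi>_def)
  qed
  obtain A' B' where AB': "A' \<in> H" "B' \<in> H"
      "card H \<le> \<kappa> ^ card (A' \<inter> B') * card (star H (A' \<inter> B'))"
    using spread_pair[OF finH _ neH R(2), of \<kappa>] H \<kappa> by auto
  then obtain A B where AB: "A \<in> Fd" "B \<in> Fd" "A' = \<Phi> A" "B' = \<Phi> B" by (auto simp: H_def)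
  define Y where "Y = A' \<inter> B'"
  have finAB: "finite A" "finite B" using AB mem by (auto simp: Fd_def)
  have YX: "Y \<inter> X = (X - A) \<inter> (X - B)" and Y_X: "Y - X = A \<inter> B - X"
    using AB by (auto simp: Y_def \<Phi>_def)
  define a where "a = card (Y \<inter> X)"
  define b where "b = card (Y - X)"
  have finY: "finite Y" using YX Y_X finAB X(1) by (metis Int_Diff_Un finite_Diff finite_Int finite_UnI)
  have cY: "card Y = a + b"
    using finY by (simp add: a_def b_def card_Int_Diff)
  have ad: "a \<le> d"
    using AB X(1) card_mono[of "X - A" "Y \<inter> X"] by (auto simp: a_def YX Fd_def)
  \<comment> \<open>Points of \<open>A \<inter> B\<close> lie in \<open>Y - X\<close> or in
    \<open>X\<close> outside both defects. The defects share \<open>a\<close> points, so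
    \<open>t \<le> t + i - (2 * d - a) + b\<close>.\<close>
  have key: "2 * d \<le> i + a + b"
  proof -
    have "t \<le> card (A \<inter> B)" using int AB by (auto simp: t_intersecting_def Fd_def)
    also have "A \<inter> B \<subseteq> (X - ((X - A) \<union> (X - B))) \<union> (Y - X)" using Y_X by blast
    hence "card (A \<inter> B) \<le> card ((X - ((X - A) \<union> (X - B))) \<union> (Y - X))"
      using X(1) finY by (intro card_mono) auto
    also have "\<dots> \<le> card (X - ((X - A) \<union> (X - B))) + b" unfolding b_def by (rule card_Un_le)
    also have "card (X - ((X - A) \<union> (X - B))) = t + i - card ((X - A) \<union> (X - B))"
      using X by (subst card_Diff_subset) auto
    finally have "t \<le> t + i - card ((X - A) \<union> (X - B)) + b" .
    moreover have "card (X - A) + card (X - B) = card ((X - A) \<union> (X - B)) + a"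
      unfolding a_def YX using X(1) by (intro card_Un_Int) auto
    moreover have "card (X - A) = d" "card (X - B) = d" using AB by (auto simp: Fd_def)
    moreover have "card ((X - A) \<union> (X - B)) \<le> t + i"
      using X card_mono[of X "(X - A) \<union> (X - B)"] by auto
    ultimately show ?thesis by linarith
  qed
  define \<D> where "\<D> = {D. Y \<inter> X \<subseteq> D \<and> D \<subseteq> X \<and> card D = d}"
  define S where "S = (\<lambda>D. star F ((X - D) \<union> (Y - X)))"
  have fin\<D>: "finite \<D>" using X(1) by (auto simp: \<D>_def)
  have "card \<D> \<le> card X ^ (d - a)"
    unfolding \<D>_def a_def using X(1) ad by (intro card_subsets_between_le) (auto simp: a_def)
  also have "\<dots> \<le> k ^ (d - a)" using X by (intro power_mono) auto
  finally have "real (card \<D>) \<le> real k ^ (d - a)" by (metis of_nat_le_iff of_nat_power)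
  also have "\<dots> \<le> K ^ (d - a)" using K by (intro power_mono) auto
  finally have c\<D>: "real (card \<D>) \<le> K ^ (d - a)" .
  have cS: "\<kappa> ^ (a + b) * K ^ (d - a) * (r ^ i * card (S D)) \<le> (\<kappa> * K) ^ i * M"
    if "D \<in> \<D>" for D
  proof -
    define B where "B = (X - D) \<union> (Y - X)"
    have D: "D \<subseteq> X" "card D = d" using that by (auto simp: \<D>_def)
    have finB: "finite B" using X(1) finY by (simp add: B_def)
    have "card B = card (X - D) + b"
      unfolding B_def b_def using X(1) finY by (intro card_Un_disjoint) auto
    also have "card (X - D) = t + i - d"
      using D X finite_subset[OF D(1)] by (simp add: card_Diff_subset)
    finally have cB: "card B = t + i - d + b" .
    show ?thesis
    proof (cases "b \<le> d")
      \<comment> \<open>\<open>B\<close> has at most \<open>t + i\<close> points, so branching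
        applies; \<open>key\<close> bounds the total exponent \<open>(d - a) + (d - b)\<close> of
        \<open>K\<close> by \<open>i\<close>.\<close>
      case True
      have base: "real (card (star F B)) \<le> M / r ^ i" if "finite B" "card B = t + i" for B
        using stars[OF that(1)] that(2) r1 by (simp add: field_simps)
      have "card B \<le> t + i" and Bd: "t + i - card B = d - b" using cB True d by linarith+
      with star_branching[where b = "M / r ^ i", OF finF mem int noncover base finB]
      have "real (card (star F B)) \<le> real k ^ (t + i - card B) * (M / r ^ i)" by blast
      hence "real (card (S D)) \<le> real k ^ (d - b) * (M / r ^ i)"
        unfolding Bd by (simp only: S_def B_def)
      hence "r ^ i * card (S D) \<le> real k ^ (d - b) * M"
        using r1 by (simp add: field_simps)
      also have "\<dots> \<le> K ^ (d - b) * M"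
        using K M by (intro mult_right_mono power_mono) auto
      finally have "\<kappa> ^ (a + b) * K ^ (d - a) * (r ^ i * card (S D))
          \<le> \<kappa> ^ (a + b) * K ^ (d - a) * (K ^ (d - b) * M)"
        using \<kappa>1 K1 by (intro mult_left_mono) auto
      also have "\<dots> = \<kappa> ^ (a + b) * K ^ ((d - a) + (d - b)) * M"
        by (simp add: power_add)
      also have "\<dots> \<le> \<kappa> ^ i * K ^ i * M"
        using \<kappa>1 K M ad d key True by (intro mult_right_mono power_balance) auto
      finally show ?thesis by (simp add: power_mult_distrib)
    next
      \<comment> \<open>\<open>B\<close> has \<open>b - d\<close> points beyond
        \<open>t + i\<close>; the resulting extra factor \<open>r ^ (b - d)\<close> pays for
        \<open>\<kappa> ^ (b - d)\<close>.\<close>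
      case False
      have "card B - t = i + (b - d)" using cB False d by linarith
      hence st: "r ^ i * r ^ (b - d) * card (S D) \<le> M"
        using stars[OF finB] cB d by (simp add: S_def B_def power_add)
      have "\<kappa> ^ (a + b) = \<kappa> ^ (b - d) * \<kappa> ^ (a + d)"
        using False by (simp add: add.commute flip: power_add)
      hence "\<kappa> ^ (a + b) * K ^ (d - a) * (r ^ i * card (S D))
          = \<kappa> ^ (a + d) * K ^ (d - a) * (r ^ i * \<kappa> ^ (b - d) * card (S D))"
        by simp
      also have "\<dots> \<le> \<kappa> ^ (a + d) * K ^ (d - a) * (r ^ i * r ^ (b - d) * card (S D))"
        using \<kappa>1 K1 r1 r by (intro mult_left_mono mult_right_mono power_mono) auto
      also have "\<dots> \<le> \<kappa> ^ (a + d) * K ^ (d - a) * M"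
        using \<kappa>1 K1 st by (intro mult_left_mono) auto
      also have "\<dots> \<le> \<kappa> ^ i * K ^ i * M"
        using \<kappa>1 K M ad d by (intro mult_right_mono power_balance) auto
      finally show ?thesis by (simp add: power_mult_distrib)
    qed
  qed
  have "star H Y \<subseteq> \<Phi> ` (\<Union>D\<in>\<D>. S D)"
  proof
    fix Z assume "Z \<in> star H Y"
    then obtain A where A: "A \<in> F" "card (X - A) = d" "Z = \<Phi> A" "Y \<subseteq> \<Phi> A"
      by (auto simp: star_def H_def Fd_def)
    have "X - A \<in> \<D>" using A by (auto simp: \<D>_def \<Phi>_def)
    moreover have "A \<in> S (X - A)" using A by (auto simp: S_def star_def \<Phi>_def)
    ultimately show "Z \<in> \<Phi> ` (\<Union>D\<in>\<D>. S D)" using A(3) by blast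
  qed
  hence "card (star H Y) \<le> card (\<Union>D\<in>\<D>. S D)"
    using fin\<D> finF by (intro surj_card_le) (auto simp: S_def finite_star)
  also have "\<dots> \<le> (\<Sum>D\<in>\<D>. card (S D))" by (rule card_UN_le[OF fin\<D>])
  finally have st: "real (card (star H Y)) \<le> (\<Sum>D\<in>\<D>. real (card (S D)))"
    by (metis of_nat_le_iff of_nat_sum)
  have "card Fd = card H" unfolding H_def using inj by (simp add: card_image)
  hence "real (card Fd) \<le> \<kappa> ^ (a + b) * card (star H Y)"
    using AB'(3) by (simp add: Y_def[symmetric] cY)
  also have "\<dots> \<le> \<kappa> ^ (a + b) * (\<Sum>D\<in>\<D>. real (card (S D)))"
    using st \<kappa>1 by (intro mult_left_mono) auto
  \<comment> \<open>The factor \<open>K ^ (d - a)\<close> brings each summand into the form of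
    \<open>cS\<close>; the number of summands returns the same factor, which then cancels.\<close>
  finally have "K ^ (d - a) * (r ^ i * card Fd)
      \<le> K ^ (d - a) * (r ^ i * (\<kappa> ^ (a + b) * (\<Sum>D\<in>\<D>. real (card (S D)))))"
    using K1 r1 by (intro mult_left_mono) auto
  also have "\<dots> = (\<Sum>D\<in>\<D>. \<kappa> ^ (a + b) * K ^ (d - a) * (r ^ i * card (S D)))"
    by (simp add: sum_distrib_left mult_ac)
  also have "\<dots> \<le> real (card \<D>) * ((\<kappa> * K) ^ i * M)"
    using cS by (intro sum_bounded_above) auto
  also have "\<dots> \<le> K ^ (d - a) * ((\<kappa> * K) ^ i * M)"
    using c\<D> \<kappa>1 K1 M by (intro mult_right_mono) auto
  finally show ?thesis using K1 by (simp add: Fd_def)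
qed

text \<open>Over a minimal cover of size \<open>t + i\<close>, each of the
  \<open>i + 1 \<le> 2 ^ i\<close> defect classes has at most \<open>M / 32 ^ i\<close> members.
  Non-triviality gives \<open>i > 0\<close>, so the sum is at most \<open>M / 16\<close>.\<close>

lemma nontrivial_spread_bound:
  fixes F :: "'a set set" and M r \<kappa> K :: real
  assumes finF: "finite F" and ne: "F \<noteq> {}" and mem: "\<And>A. A \<in> F \<Longrightarrow> finite A \<and> card A \<le> k"
    and nontriv: "nontrivial_t_intersecting t F"
    and stars: "\<And>B. finite B \<Longrightarrow> t \<le> card B \<Longrightarrow> r ^ (card B - t) * card (star F B) \<le> M"
    and R: "2 * k < 2 ^ R" "R > 0" and \<kappa>: "\<kappa> = 16 * real R"
    and K: "\<kappa> \<le> K" "real k \<le> K" and r: "32 * (\<kappa> * K) \<le> r"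
  shows "real (card F) \<le> M / 2"
proof -
  have int: "t_intersecting t F" and small: "card (\<Inter>F) < t"
    using nontriv by (auto simp: nontrivial_t_intersecting_def)
  obtain A\<^sub>0 where A\<^sub>0: "A\<^sub>0 \<in> F" using ne by blast
  define cover where "cover = (\<lambda>X. finite X \<and> (\<forall>A\<in>F. t \<le> card (X \<inter> A)))"
  have "cover A\<^sub>0" using int A\<^sub>0 mem by (auto simp: cover_def t_intersecting_def)
  from ex_has_least_nat[of cover, OF this, of card] obtain X
    where X: "cover X" and Xmin: "\<And>Y. cover Y \<Longrightarrow> card X \<le> card Y" by blast
  have finX: "finite X" using X by (simp add: cover_def)
  have cXk: "card X \<le> k" using Xmin[OF \<open>cover A\<^sub>0\<close>] mem[OF A\<^sub>0] by simp
  \<comment> \<open>A cover with at most \<open>t\<close> points would lie in every member, hence in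
    \<open>\<Inter>F\<close>, which is too small.\<close>
  have "t < card X"
  proof (rule ccontr)
    assume "\<not> t < card X"
    have "X \<subseteq> A" if "A \<in> F" for A
    proof -
      have "card X \<le> card (X \<inter> A)" using X that \<open>\<not> t < card X\<close> by (force simp: cover_def)
      thus ?thesis using card_seteq[OF finX, of "X \<inter> A"] by blast
    qed
    hence "X \<subseteq> \<Inter>F" by blast
    moreover have "finite (\<Inter>F)" using A\<^sub>0 mem by (meson Inter_lower finite_subset)
    ultimately have "card X \<le> card (\<Inter>F)" by (simp add: card_mono)
    moreover have "t \<le> card X"
      using X A\<^sub>0 card_mono[OF finX, of "X \<inter> A\<^sub>0"] by (force simp: cover_def)
    ultimately show False using small by simp
  qed
  define i where "i = card X - t"
  have i: "card X = t + i" "0 < i" using \<open>t < card X\<close> by (auto simp: i_def)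
  have noncover: "\<exists>G\<in>F. card (B \<inter> G) < t" if "finite B" "card B < t + i" for B
    using Xmin[of B] that i by (force simp: cover_def)
  define Fd where "Fd = (\<lambda>d. {A \<in> F. card (X - A) = d})"
  have \<kappa>1: "1 \<le> \<kappa>" using R \<kappa> by simp
  have K1: "1 \<le> K" using \<kappa>1 K by linarith
  have \<kappa>r: "\<kappa> \<le> r"
  proof -
    have "\<kappa> * 1 \<le> \<kappa> * (32 * K)" using \<kappa>1 K1 by (intro mult_left_mono) auto
    thus ?thesis using r by simp
  qed
  have M: "0 \<le> M" using stars[OF finX] i \<kappa>1 \<kappa>r
    by (smt (verit) le_add1 of_nat_0_le_iff zero_le_mult_iff zero_le_power)
  have Fd: "real (card (Fd d)) \<le> M / 32 ^ i" if "d \<le> i" for d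
  proof -
    have "(32 * (\<kappa> * K)) ^ i * card (Fd d) \<le> r ^ i * card (Fd d)"
      using r \<kappa>1 K1 by (intro mult_right_mono power_mono) auto
    also have "\<dots> \<le> (\<kappa> * K) ^ i * M"
      unfolding Fd_def
      using cover_defect_bound[OF finF mem int finX i(1) _ noncover stars R \<kappa> K \<kappa>r that] i cXk
      by simp
    finally have "(\<kappa> * K) ^ i * (32 ^ i * real (card (Fd d))) \<le> (\<kappa> * K) ^ i * M"
      by (simp only: power_mult_distrib mult_ac)
    moreover have "0 < (\<kappa> * K) ^ i" using \<kappa>1 K1 by simp
    ultimately have "32 ^ i * real (card (Fd d)) \<le> M" by (rule mult_left_le_imp_le)
    thus ?thesis by (simp add: field_simps)
  qed
  have "F \<subseteq> (\<Union>d\<in>{..i}. Fd d)"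
  proof
    fix A assume A: "A \<in> F"
    hence "t \<le> card (X \<inter> A)" using X by (simp add: cover_def)
    moreover have "card X = card (X \<inter> A) + card (X - A)" using finX by (rule card_Int_Diff)
    ultimately have "card (X - A) \<le> i" using i by linarith
    thus "A \<in> (\<Union>d\<in>{..i}. Fd d)" using A by (simp add: Fd_def)
  qed
  hence "card F \<le> card (\<Union>d\<in>{..i}. Fd d)"
    using finF by (intro card_mono) (auto simp: Fd_def)
  also have "\<dots> \<le> (\<Sum>d\<in>{..i}. card (Fd d))" by (rule card_UN_le) simp
  finally have "real (card F) \<le> (\<Sum>d\<in>{..i}. real (card (Fd d)))"
    by (metis of_nat_le_iff of_nat_sum)
  also have "\<dots> \<le> real (card {..i}) * (M / 32 ^ i)"
    using Fd by (intro sum_bounded_above) auto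
  also have "\<dots> \<le> 2 ^ i * (M / 32 ^ i)"
  proof (rule mult_right_mono)
    have "card {..i} \<le> 2 ^ i" by (simp add: Suc_le_eq less_exp)
    thus "real (card {..i}) \<le> 2 ^ i" by (metis of_nat_le_iff of_nat_numeral of_nat_power)
  qed (use M in simp)
  also have "\<dots> = M * (1 / 16) ^ i"
  proof -
    have "(32::real) ^ i = 2 ^ i * 16 ^ i" by (simp flip: power_mult_distrib)
    thus ?thesis by (simp add: power_divide)
  qed
  also have "\<dots> \<le> M * (1 / 16) ^ 1"
    using M i by (intro mult_left_mono power_decreasing) auto
  finally show ?thesis using M by simp
qed

section \<open>Stars in a simplicial complex with large facets\<close>

lemma finite_simplicial_complex: "simplicial_complex N C \<Longrightarrow> finite C"
  unfolding simplicial_complex_def by (meson finite_Pow_iff finite_atLeastAtMost finite_subset)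

lemma simplicial_complex_face:
  assumes "simplicial_complex N C" "A \<in> C"
  shows "A \<subseteq> {1..N}" "finite A"
  using assms finite_subset[of A "{1..N}"] by (auto simp: simplicial_complex_def)

lemma maximal_superset:
  assumes "finite C" "A \<in> C"
  obtains B where "inclusion_maximal C B" "A \<subseteq> B"
proof -
  obtain B where "B \<in> C" "A \<subseteq> B" "\<forall>D\<in>C. B \<subseteq> D \<longrightarrow> B = D"
    using finite_has_maximal2[OF assms] by blast
  hence "inclusion_maximal C B" by (auto simp: inclusion_maximal_def)
  thus ?thesis using \<open>A \<subseteq> B\<close> by (rule that)
qed

text \<open>Deleting \<open>x\<close> injects the smaller star into the \<open>(k - 1)\<close>-faces
  over \<open>B\<close>. Each of these lies in a facet, so it extends by one point in at least
  \<open>n - (k - 1)\<close> ways, and every \<open>k\<close>-face over \<open>B\<close> arises at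
  most \<open>k\<close> times.\<close>

lemma star_insert_layer_le:
  assumes C: "simplicial_complex N C"
    and max: "\<And>A. inclusion_maximal C A \<Longrightarrow> n \<le> card A"
    and k: "0 < k" and x: "x \<notin> B"
  shows "(n + 1 - k) * card (star (layer C k) (insert x B)) \<le> k * card (star (layer C k) B)"
proof -
  note mem = simplicial_complex_face[OF C] and finC = finite_simplicial_complex[OF C]
  have down: "A \<in> C" if "A' \<in> C" "A \<subseteq> A'" for A A'
    using C that by (auto simp: simplicial_complex_def)
  have fin: "finite (star (layer C j) D)" for j D
    using finC by (simp add: finite_star layer_def)
  have fin_ext: "finite {y. y \<notin> G \<and> insert y G \<in> C}" for G
  proof (rule finite_subset)
    show "{y. y \<notin> G \<and> insert y G \<in> C} \<subseteq> {1..N}" using mem(1) by blast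
  qed simp
  define S where "S = star (layer C (k - 1)) B"
  define P where "P = (SIGMA G:S. {y. y \<notin> G \<and> insert y G \<in> C})"
  define Q where "Q = (SIGMA A:star (layer C k) B. A)"
  have up: "n + 1 - k \<le> card {y. y \<notin> G \<and> insert y G \<in> C}" if "G \<in> S" for G
  proof -
    have G: "G \<in> C" "card G = k - 1" using that by (auto simp: S_def star_def layer_def)
    obtain A where A: "inclusion_maximal C A" "G \<subseteq> A" using maximal_superset[OF finC G(1)] .
    hence AC: "A \<in> C" by (simp add: inclusion_maximal_def)
    have "n + 1 - k \<le> card (A - G)"
      using max[OF A(1)] G(2) k A(2) mem(2)[OF G(1)] by (simp add: card_Diff_subset)
    also have "\<dots> \<le> card {y. y \<notin> G \<and> insert y G \<in> C}"
    proof (rule card_mono[OF fin_ext])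
      show "A - G \<subseteq> {y. y \<notin> G \<and> insert y G \<in> C}"
        using down[OF AC] A(2) by auto
    qed
    finally show ?thesis .
  qed
  have "card (star (layer C k) (insert x B)) \<le> card S"
  proof (rule card_inj_on_le[where f = "\<lambda>A. A - {x}"])
    show "inj_on (\<lambda>A. A - {x}) (star (layer C k) (insert x B))"
      by (rule inj_onI) (auto simp: star_def)
    show "(\<lambda>A. A - {x}) ` star (layer C k) (insert x B) \<subseteq> S"
      using x mem(2) by (auto simp: S_def star_def layer_def intro: down)
  qed (simp add: S_def fin)
  hence "(n + 1 - k) * card (star (layer C k) (insert x B)) \<le> (n + 1 - k) * card S"
    by (rule mult_le_mono2)
  also have "\<dots> \<le> (\<Sum>G\<in>S. card {y. y \<notin> G \<and> insert y G \<in> C})"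
    using sum_bounded_below[of S "n + 1 - k"] up by (simp add: mult.commute)
  also have "\<dots> = card P"
    unfolding P_def
    by (rule card_SigmaI[symmetric]) (simp_all add: S_def fin fin_ext)
  also have "\<dots> \<le> card Q"
  proof (rule card_inj_on_le[where f = "\<lambda>(G, y). (insert y G, y)"])
    show "inj_on (\<lambda>(G, y). (insert y G, y)) P"
      by (rule inj_on_inverseI[where g = "\<lambda>(A, y). (A - {y}, y)"]) (auto simp: P_def)
    show "(\<lambda>(G, y). (insert y G, y)) ` P \<subseteq> Q"
      using k mem(2) by (auto simp: P_def Q_def S_def star_def layer_def)
    show "finite Q"
      unfolding Q_def using fin mem(2) by (intro finite_SigmaI) (auto simp: star_def layer_def)
  qed
  also have "\<dots> = (\<Sum>A\<in>star (layer C k) B. card A)"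
    unfolding Q_def using fin mem(2) by (intro card_SigmaI) (auto simp: star_def layer_def)
  also have "\<dots> = k * card (star (layer C k) B)"
    by (simp add: star_def layer_def)
  finally show ?thesis .
qed

text \<open>Iterates the one-point estimate over \<open>Z\<close>; each added point costs a factor
  \<open>r\<close>, since \<open>r\<close> is at most \<open>(n + 1 - k) / k\<close>.\<close>

lemma star_layer_spread:
  fixes r :: real
  assumes C: "simplicial_complex N C"
    and max: "\<And>A. inclusion_maximal C A \<Longrightarrow> n \<le> card A"
    and k: "0 < k" and r: "0 \<le> r" "r * k \<le> real (n + 1 - k)"
    and Z: "finite Z" "Z \<inter> T = {}"
  shows "r ^ card Z * card (star (layer C k) (T \<union> Z)) \<le> card (star (layer C k) T)"
  using Z
proof (induction Z rule: finite_induct)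
  case (insert x Z)
  let ?s = "\<lambda>B. real (card (star (layer C k) B))"
  have "r * real k * ?s (insert x (T \<union> Z)) \<le> real (n + 1 - k) * ?s (insert x (T \<union> Z))"
    using r by (intro mult_right_mono) auto
  also have "\<dots> \<le> real k * ?s (T \<union> Z)"
    using star_insert_layer_le[OF C max k, of x "T \<union> Z"] insert
    by (simp flip: of_nat_mult)
  finally have "r * ?s (insert x (T \<union> Z)) \<le> ?s (T \<union> Z)" using k by simp
  hence "r ^ card Z * (r * ?s (insert x (T \<union> Z))) \<le> r ^ card Z * ?s (T \<union> Z)"
    using r by (intro mult_left_mono) auto
  also have "\<dots> \<le> ?s T" using insert by simp
  finally show ?case using insert by (simp add: mult_ac)
qed simp

section \<open>Choice of constants and the extremal families\<close>

lemma nontrivial_bound: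
  fixes N n k t :: nat and C :: "nat set set"
  assumes t: "t > 0" and k: "k > 0"
    and C: "simplicial_complex N C"
    and max: "\<And>A. inclusion_maximal C A \<Longrightarrow> n \<le> card A"
    and n: "real n \<ge> 2 ^ 18 * (real k)\<^sup>2 * log 2 (real k)"
    and F: "F \<subseteq> layer C k" "nontrivial_t_intersecting t F"
  shows "\<exists>T. finite T \<and> card T = t \<and> real (card F) \<le> 1 / 2 * real (card (star (layer C k) T))"
proof (cases "F = {}")
  case True
  \<comment> \<open>The empty family counts as non-trivial because \<open>card UNIV\<close> defaults
    to 0; any \<open>t\<close>-set bounds it.\<close>
  thus ?thesis by (intro exI[of _ "{1..t}"]) simp
next
  case ne: False
  have finL: "finite (layer C k)" using finite_simplicial_complex[OF C] by (simp add: layer_def)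
  have finF: "finite F" using F(1) finL by (rule finite_subset)
  have mem: "A \<subseteq> {1..N}" "finite A" "card A = k" if "A \<in> F" for A
    using that F(1) simplicial_complex_face[OF C] by (auto simp: layer_def)
  have int: "t_intersecting t F" and small: "card (\<Inter>F) < t"
    using F(2) by (auto simp: nontrivial_t_intersecting_def)
  obtain A\<^sub>0 where A\<^sub>0: "A\<^sub>0 \<in> F" using ne by blast
  have tk: "t \<le> k" using int A\<^sub>0 mem(3)[OF A\<^sub>0] unfolding t_intersecting_def by fastforce
  \<comment> \<open>For \<open>t = k\<close> the family would be a singleton and hence trivial.
    Consequently \<open>k \<ge> 2\<close>, which makes the logarithm at least 1.\<close>
  have "t \<noteq> k"
  proof
    assume "t = k"
    have "A = A\<^sub>0" if "A \<in> F" for A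
    proof -
      have "card A\<^sub>0 \<le> card (A\<^sub>0 \<inter> A)" "card A \<le> card (A\<^sub>0 \<inter> A)"
        using int that A\<^sub>0 mem(3) \<open>t = k\<close> by (auto simp: t_intersecting_def)
      hence "A\<^sub>0 \<inter> A = A\<^sub>0" and "A\<^sub>0 \<inter> A = A"
        using card_seteq[OF mem(2)[OF A\<^sub>0] Int_lower1] card_seteq[OF mem(2)[OF that] Int_lower2]
        by blast+
      thus ?thesis by simp
    qed
    hence "F = {A\<^sub>0}" using A\<^sub>0 by blast
    thus False using small mem(3)[OF A\<^sub>0] \<open>t = k\<close> by simp
  qed
  hence k2: "k \<ge> 2" using tk t by linarith
  define L where "L = log 2 (real k)"
  define R where "R = nat \<lfloor>L\<rfloor> + 2"
  define r where "r = real (n + 1 - k) / real k"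
  have L1: "1 \<le> L" using k2 by (simp add: L_def le_log_iff)
  have Lk: "L \<le> real k"
  proof -
    have "real k \<le> 2 powr real k"
      using of_nat_less_two_power[of k, where 'a = real] by (simp add: powr_realpow)
    thus ?thesis using k2 by (simp add: L_def log_le_iff)
  qed
  have R: "real R = of_int \<lfloor>L\<rfloor> + 2" using L1 by (simp add: R_def)
  have RL: "real R \<le> 3 * L" and LR: "L + 1 < real R" using L1 unfolding R by linarith+
  have pow: "2 * k < 2 ^ R"
  proof -
    have "real (2 * k) = 2 powr (L + 1)" using k2 by (simp add: L_def powr_add)
    also have "\<dots> < 2 powr real R" using LR by simp
    also have "\<dots> = real (2 ^ R)" by (simp add: powr_realpow)
    finally show ?thesis by (simp only: of_nat_less_iff)
  qed
  \<comment> \<open>Here \<open>\<kappa> = 16 * R\<close> and \<open>K = 48 * k\<close>, with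
    \<open>\<kappa> \<le> K\<close> because \<open>R \<le> 3 * L \<le> 3 * k\<close>. The product
    \<open>32 * 16 * 3 * 48 = 73728\<close> is below \<open>2 ^ 18\<close>, and the gap absorbs the
    \<open>- k\<close> in \<open>n + 1 - k\<close>.\<close>
  have r: "32 * (16 * real R * (48 * real k)) \<le> r"
  proof -
    have "32 * (16 * real R * (48 * real k)) * real k \<le> 32 * (16 * (3 * L) * (48 * real k)) * real k"
      using RL by (intro mult_right_mono mult_left_mono) auto
    also have "\<dots> = 73728 * ((real k)\<^sup>2 * L)" by (simp add: power2_eq_square)
    also have "\<dots> \<le> 262144 * ((real k)\<^sup>2 * L) - real k"
    proof -
      have "real k * 1 \<le> real k * (real k * L)"
        using k2 L1 mult_mono[of 1 "real k" 1 L] by (intro mult_left_mono) auto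
      hence "real k \<le> (real k)\<^sup>2 * L" by (simp add: power2_eq_square)
      moreover have "0 \<le> (real k)\<^sup>2 * L" using L1 by simp
      ultimately show ?thesis by linarith
    qed
    also have "\<dots> \<le> real n - real k" using n by (simp add: L_def mult.assoc)
    also have "\<dots> \<le> real (n + 1 - k)" by linarith
    finally show ?thesis using k by (simp add: r_def field_simps)
  qed
  have r0: "0 \<le> r" "r * k \<le> real (n + 1 - k)" using k by (simp_all add: r_def)
  define \<T> where "\<T> = {T. T \<subseteq> {1..N} \<and> card T = t}"
  obtain T\<^sub>1 where "T\<^sub>1 \<subseteq> A\<^sub>0" "card T\<^sub>1 = t"
    using obtain_subset_with_card_n[of t A\<^sub>0] mem(3)[OF A\<^sub>0] tk by metis
  hence "T\<^sub>1 \<in> \<T>" using mem(1)[OF A\<^sub>0] by (auto simp: \<T>_def)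
  hence "(\<lambda>T. card (star (layer C k) T)) ` \<T> \<noteq> {}" (is "?I \<noteq> _") by blast
  moreover have finI: "finite ?I" by (simp add: \<T>_def)
  ultimately have "Max ?I \<in> ?I" by (intro Max_in)
  then obtain T where T: "T \<in> \<T>" and "Max ?I = card (star (layer C k) T)" by (rule imageE)
  hence Tmax: "card (star (layer C k) T') \<le> card (star (layer C k) T)" if "T' \<in> \<T>" for T'
    using Max_ge[OF finI imageI[OF that]] by simp
  have "real (card F) \<le> real (card (star (layer C k) T)) / 2"
  proof (rule nontrivial_spread_bound[OF finF ne _ F(2), of k r _ R "16 * real R" "48 * real k"])
    fix B :: "nat set" assume B: "finite B" "t \<le> card B"
    show "r ^ (card B - t) * card (star F B) \<le> card (star (layer C k) T)"
    proof (cases "star F B = {}")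
      case False
      then obtain A where "A \<in> F" "B \<subseteq> A" by (auto simp: star_def)
      hence BN: "B \<subseteq> {1..N}" using mem(1) by blast
      obtain T' where T': "T' \<subseteq> B" "card T' = t"
        using obtain_subset_with_card_n[OF B(2)] by metis
      have finT': "finite T'" using T'(1) B(1) by (rule finite_subset)
      have "card (star F B) \<le> card (star (layer C k) B)"
        using finL F(1) by (intro card_mono) (auto simp: star_def)
      hence "r ^ (card B - t) * card (star F B) \<le> r ^ card (B - T') * card (star (layer C k) (T' \<union> (B - T')))"
        using T' finT' r0 by (simp add: card_Diff_subset Un_absorb1 mult_left_mono)
      also have "\<dots> \<le> card (star (layer C k) T')"
        using B(1) by (intro star_layer_spread[OF C max k r0]) auto
      also have "\<dots> \<le> card (star (layer C k) T)"
        using Tmax[of T'] T' BN by (auto simp: \<T>_def)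
      finally show ?thesis .
    qed simp
  qed (use mem pow R_def RL Lk r in auto)
  moreover have "finite T" using T finite_subset[of T "{1..N}"] by (simp add: \<T>_def)
  ultimately show ?thesis using T by (intro exI[of _ T]) (simp add: \<T>_def)
qed

theorem theorem6:
  fixes N n k t :: nat and C :: "nat set set"
  assumes "n > 0" and "k > 0" and "t > 0" and "k \<ge> t"
    and "simplicial_complex N C"
    and "\<And>A. inclusion_maximal C A \<Longrightarrow> card A \<ge> n"
    and "real n \<ge> 2 ^ 18 * (real k)\<^sup>2 * log 2 (real k)"
  shows "(\<forall>F. maximum_t_intersecting t (layer C k) F \<longrightarrow>
            (\<exists>T. finite T \<and> card T = t \<and> F = star (layer C k) T)) \<and>
         (\<forall>F. F \<subseteq> layer C k \<and> nontrivial_t_intersecting t F \<longrightarrow>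
            (\<exists>T. finite T \<and> card T = t \<and>
                 real (card F) \<le> 1 / 2 * real (card (star (layer C k) T))))"
proof (intro conjI allI impI)
  fix F assume "F \<subseteq> layer C k \<and> nontrivial_t_intersecting t F"
  thus "\<exists>T. finite T \<and> card T = t \<and> real (card F) \<le> 1 / 2 * real (card (star (layer C k) T))"
    using nontrivial_bound[OF assms(3,2,5,6,7)] by blast
next
  fix F assume "maximum_t_intersecting t (layer C k) F"
  hence F: "F \<subseteq> layer C k" "t_intersecting t F"
    and Fmax: "\<And>G. G \<subseteq> layer C k \<Longrightarrow> t_intersecting t G \<Longrightarrow> card G \<le> card F"
    by (auto simp: maximum_t_intersecting_def)
  have finL: "finite (layer C k)" using finite_simplicial_complex[OF assms(5)] by (simp add: layer_def)
  have finF: "finite F" using F(1) finL by (rule finite_subset)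
  have mem: "finite A" "card A = k" if "A \<in> layer C k" for A
    using that simplicial_complex_face[OF assms(5)] by (auto simp: layer_def)
  have star_int: "t_intersecting t (star (layer C k) T)" if "card T = t" for T
    unfolding t_intersecting_def star_def that[symmetric]
    by (intro ballI card_mono finite_Int) (auto dest: mem(1))
  have star_le: "card (star (layer C k) T) \<le> card F" if "card T = t" for T
    using star_int[OF that] by (intro Fmax) (auto simp: star_def)
  show "\<exists>T. finite T \<and> card T = t \<and> F = star (layer C k) T"
  proof (cases "F = {}")
    case True
    have "layer C k = {}"
    proof (rule ccontr)
      assume "layer C k \<noteq> {}"
      then obtain A where A: "A \<in> layer C k" by blast
      \<comment> \<open>A single face is \<open>t\<close>-intersecting as \<open>t \<le> k\<close>,
        so an empty maximum forces an empty layer, all of whose stars are empty.\<close>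
      have "card {A} \<le> card F" using A mem(2)[OF A] assms(4) by (intro Fmax) (auto simp: t_intersecting_def)
      thus False using True by simp
    qed
    thus ?thesis using True by (intro exI[of _ "{1..t}"]) (simp add: star_def)
  next
    case False
    then obtain A where A: "A \<in> F" by blast
    \<comment> \<open>A non-trivial maximum would have at most half the size of some star, while
      stars are themselves \<open>t\<close>-intersecting and so no larger than
      \<open>F\<close>.\<close>
    have "t \<le> card (\<Inter>F)"
    proof (rule ccontr)
      assume "\<not> t \<le> card (\<Inter>F)"
      hence "nontrivial_t_intersecting t F" using F(2) by (simp add: nontrivial_t_intersecting_def)
      then obtain T where T: "card T = t" "real (card F) \<le> 1 / 2 * real (card (star (layer C k) T))"
        using nontrivial_bound[OF assms(3,2,5,6,7) F(1)] by blast
      have "0 < card F" using False finF by (simp add: card_gt_0_iff)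
      thus False using T(2) star_le[OF T(1)] by linarith
    qed
    then obtain T where T: "T \<subseteq> \<Inter>F" "card T = t"
      using obtain_subset_with_card_n by metis
    have "F \<subseteq> star (layer C k) T" using T F(1) by (auto simp: star_def)
    hence "F = star (layer C k) T"
      using star_le[OF T(2)] finL by (intro card_seteq) (auto simp: finite_star)
    moreover have "finite T" using T(2) assms(3) card_ge_0_finite by blast
    ultimately show ?thesis using T(2) by blast
  qed
qed

end
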